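(* Let $w$ be any basis monomial of $\mathbf A=\operatorname{Alg}(v_0,v_1)$ (an element of the set $\mathcal B$ described in the context), and let $(Z_1,Z_2)=(\operatorname{wt}(w),\operatorname{swt}(w))$ be its weight coordinates. Then $$|Z_2|<\log_2 Z_1+3 .$$
   Context: Let $K$ be a field and $\Lambda=\Lambda(x_i\mid i\ge 0)$ the Grassmann (exterior) algebra over $K$ on odd generators $x_0,x_1,\dots$. In $\operatorname{End}\Lambda$ identify $x_i$ with left multiplication by $x_i$, and let $\partial_i$ be the odd superderivation of $\Lambda$ with $\partial_i(x_j)=\delta_{ij}$. The pivot elements are $v_i=\partial_i+x_ix_{i+1}(\partial_{i+2}+x_{i+2}x_{i+3}(\partial_{i+4}+\cdots))$, $i\ge 0$, i.e. $v_i=\partial_i+x_ix_{i+1}v_{i+2}$; $\mathbf A=\operatorname{Alg}(v_0,v_1)$ is the associative subalgebra (without unit) of $\operatorname{End}\Lambda$ generated by $v_0,v_1$. The set $\mathcal B$ of basis monomials (a basis of $\mathbf A$ if $\operatorname{char}K\ne 2$; if $\operatorname{char} K=2$ its span contains $\mathbf A$) consists of: $v_0$; $v_1v_0^{\alpha_0}$; $x_0^{\xi_0}x_1^{\xi_1}v_2v_1^{\alpha_1}v_0^{\alpha_0}$ with $\xi_0+\xi_1\le 1$; and, for $n\ge 3$, $x_0^{\xi_0}\cdots x_{n-1}^{\xi_{n-1}}v_nv_{n-1}^{\alpha_{n-1}}\cdots v_0^{\alpha_0}$ with $\xi_{n-2}+\xi_{n-1}\le 1+\alpha_{n-1}$,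 where all $\xi_i,\alpha_i\in\{0,1\}$, and where for $n=3$ the only monomials included which contain both $x_0$ and $x_2$ are $x_0x_2v_3v_2v_1^{\alpha_1}v_0^{\alpha_0}$. The weight and superweight of monomials in the $x_i,v_i$ are defined additively on products by $\operatorname{wt}(v_n)=-\operatorname{wt}(x_n)=2^n$ and $\operatorname{swt}(v_n)=-\operatorname{swt}(x_n)=(-1)^n$. *)

theory Defs
  imports Complex_Main "HOL-Library.FSet" "HOL-Library.Poly_Mapping"
begin

section \<open>The Grassmann algebra on countably many generators\<close>

text \<open>
  The Grassmann algebra is the free module on the monomials
  \<open>x_S = x_{s_1} \<cdots> x_{s_m}\<close>, where \<open>S = {s_1 < \<dots> < s_m}\<close> is a finite set of indices.
\<close>

type_synonym 'k grassmann = "nat fset \<Rightarrow>\<^sub>0 'k"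

type_synonym 'k operator = "'k grassmann \<Rightarrow> 'k grassmann"

definition gscale :: "'k::field \<Rightarrow> 'k grassmann \<Rightarrow> 'k grassmann" where
  "gscale c = Poly_Mapping.map ((*) c)"

definition lin_ext :: "(nat fset \<Rightarrow> 'k::field grassmann) \<Rightarrow> 'k operator" where
  "lin_ext \<phi> f = (\<Sum>S\<in>Poly_Mapping.keys f. gscale (Poly_Mapping.lookup f S) (\<phi> S))"

text \<open>The sign of the permutation that sorts the concatenation of \<open>S\<close> and \<open>T\<close>.\<close>

definition gsign :: "nat fset \<Rightarrow> nat fset \<Rightarrow> 'k::field" where
  "gsign S T = (- 1) ^ card {(s, t). s |\<in>| S \<and> t |\<in>| T \<and> t < s}"

definition gmul :: "'k::field grassmann \<Rightarrow> 'k grassmann \<Rightarrow> 'k grassmann" where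
  "gmul f g = lin_ext (\<lambda>S. lin_ext (\<lambda>T.
     if S |\<inter>| T = {||} then Poly_Mapping.single (S |\<union>| T) (gsign S T) else 0) g) f"

definition gone :: "'k::field grassmann" where
  "gone = Poly_Mapping.single {||} 1"

definition gen :: "nat \<Rightarrow> 'k::field grassmann" where
  "gen i = Poly_Mapping.single {|i|} 1"

definition X :: "nat \<Rightarrow> 'k::field operator" where
  "X i = gmul (gen i)"

text \<open>
  The coefficient \<open>gsign {|i|} S\<close> is \<open>(-1)\<close> to the number of elements of \<open>S\<close> below \<open>i\<close>.
  See \<open>del_superderivation\<close>, \<open>del_odd\<close> and \<open>del_gen\<close> below for the defining properties.
\<close>

definition del :: "nat \<Rightarrow> 'k::field operator" where
  "del i = lin_ext (\<lambda>S.
     if i |\<in>| S then Poly_Mapping.single (S |-| {|i|}) (gsign {|i|} S) else 0)"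

definition parity_part :: "bool \<Rightarrow> 'k::field grassmann set" where
  "parity_part b = {f. \<forall>S\<in>Poly_Mapping.keys f. even (fcard S) = b}"

text \<open>The automorphism acting as \<open>1\<close> on even and as \<open>-1\<close> on odd elements.\<close>

definition grade_involution :: "'k::field operator" where
  "grade_involution = lin_ext (\<lambda>S. Poly_Mapping.single S ((- 1) ^ fcard S))"


section \<open>Pivot elements, basis monomials and weights\<close>

text \<open>
  \<open>pivot_summand i k\<close> is
  \<open>x_i x_{i+1} x_{i+2} x_{i+3} \<cdots> x_{i+2k-2} x_{i+2k-1} \<partial>_{i+2k}\<close>; on any given element all but
  finitely many of these summands vanish (lemma \<open>finite_pivot_summand\<close>), so that the sum
  defining \<open>V i\<close> makes sense and \<open>V i = \<partial>_i + x_i x_{i+1} V (i+2)\<close> (lemma \<open>V_rec\<close>).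
\<close>

primrec pivot_summand :: "nat \<Rightarrow> nat \<Rightarrow> 'k::field operator" where
  "pivot_summand i 0 = del i"
| "pivot_summand i (Suc k) = X i \<circ> X (Suc i) \<circ> pivot_summand (i + 2) k"

definition V :: "nat \<Rightarrow> 'k::field operator" where
  "V i f = Sum_any (\<lambda>k. pivot_summand i k f)"

text \<open>\<open>x_0^{\<xi>_0} \<cdots> x_{n-1}^{\<xi>_{n-1}}\<close> and \<open>v_{n-1}^{\<alpha>_{n-1}} \<cdots> v_0^{\<alpha>_0}\<close>\<close>

primrec X_prod :: "(nat \<Rightarrow> nat) \<Rightarrow> nat \<Rightarrow> 'k::field operator" where
  "X_prod \<xi> 0 = id"
| "X_prod \<xi> (Suc n) = X_prod \<xi> n \<circ> (X n ^^ \<xi> n)"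

primrec V_prod :: "(nat \<Rightarrow> nat) \<Rightarrow> nat \<Rightarrow> 'k::field operator" where
  "V_prod \<alpha> 0 = id"
| "V_prod \<alpha> (Suc n) = (V n ^^ \<alpha> n) \<circ> V_prod \<alpha> n"

definition basis_monomials :: "'k::field operator set" where
  "basis_monomials =
     {V 0}
   \<union> {V 1 \<circ> V_prod \<alpha> 1 |\<alpha>. range \<alpha> \<subseteq> {0, 1}}
   \<union> {X_prod \<xi> 2 \<circ> V 2 \<circ> V_prod \<alpha> 2 |\<xi> \<alpha>.
        range \<xi> \<subseteq> {0, 1} \<and> range \<alpha> \<subseteq> {0, 1} \<and> \<xi> 0 + \<xi> 1 \<le> 1}
   \<union> {X_prod \<xi> n \<circ> V n \<circ> V_prod \<alpha> n |n \<xi> \<alpha>.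
        3 \<le> n \<and> range \<xi> \<subseteq> {0, 1} \<and> range \<alpha> \<subseteq> {0, 1} \<and>
        \<xi> (n - 2) + \<xi> (n - 1) \<le> 1 + \<alpha> (n - 1) \<and>
        (n = 3 \<and> \<xi> 0 = 1 \<and> \<xi> 2 = 1 \<longrightarrow> \<xi> 1 = 0 \<and> \<alpha> 2 = 1)}"

text \<open>
  \<open>has_weights w z1 z2\<close> means that \<open>w\<close> is a product of operators \<open>x_i\<close>, \<open>v_i\<close> whose weights add
  up to \<open>z1\<close> and whose superweights add up to \<open>z2\<close>. Every element of \<open>basis_monomials\<close> has
  such weights (lemma \<open>basis_monomial_has_weights\<close>). The zero operator is a product of this kind
  in many ways, so that weights are determined by the operator only if it is nonzero.
\<close>

inductive has_weights :: "'k::field operator \<Rightarrow> int \<Rightarrow> int \<Rightarrow> bool" where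
  weights_X: "has_weights (X n) (- (2 ^ n)) (- ((- 1) ^ n))"
| weights_V: "has_weights (V n) (2 ^ n) ((- 1) ^ n)"
| weights_mult: "has_weights u a b \<Longrightarrow> has_weights w c d \<Longrightarrow> has_weights (u \<circ> w) (a + c) (b + d)"


section \<open>The definitions have the expected properties\<close>

lemma lookup_gscale [simp]: "Poly_Mapping.lookup (gscale c f) S = c * Poly_Mapping.lookup f S"
  by (simp add: gscale_def Poly_Mapping.map.rep_eq when_def)

global_interpretation grassmann: vector_space "gscale :: 'k::field \<Rightarrow> _"
  by unfold_locales
     (rule poly_mapping_eqI, simp add: lookup_add distrib_left distrib_right mult.assoc)+

lemma gscale_zero [simp]: "gscale c 0 = 0"
  by (rule poly_mapping_eqI) simp

lemma gscale_single [simp]: "gscale c (Poly_Mapping.single S d) = Poly_Mapping.single S (c * d)"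
  by (rule poly_mapping_eqI) (simp add: lookup_single when_def)

lemma lin_ext_superset:
  assumes "finite A" "Poly_Mapping.keys f \<subseteq> A"
  shows "lin_ext \<phi> f = (\<Sum>S\<in>A. gscale (Poly_Mapping.lookup f S) (\<phi> S))"
  unfolding lin_ext_def using assms
  by (intro sum.mono_neutral_left) (auto simp: in_keys_iff)

lemma lin_ext_add: "lin_ext \<phi> (f + g) = lin_ext \<phi> f + lin_ext \<phi> g"
proof -
  let ?A = "Poly_Mapping.keys f \<union> Poly_Mapping.keys g"
  have "finite ?A" by simp
  then show ?thesis
    using Poly_Mapping.keys_add[of f g]
    by (simp add: lin_ext_superset[of ?A] lookup_add grassmann.scale_left_distrib sum.distrib)
qed

lemma lin_ext_scale: "lin_ext \<phi> (gscale c f) = gscale c (lin_ext \<phi> f)"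
proof -
  have "Poly_Mapping.keys (gscale c f) \<subseteq> Poly_Mapping.keys f"
    by (auto simp: in_keys_iff)
  then show ?thesis
    by (simp add: lin_ext_superset[of "Poly_Mapping.keys f"] grassmann.scale_sum_right)
qed

lemma linear_lin_ext: "Vector_Spaces.linear gscale gscale (lin_ext \<phi>)"
  by unfold_locales (simp_all add: lin_ext_add lin_ext_scale)

lemma lin_ext_single [simp]: "lin_ext \<phi> (Poly_Mapping.single S c) = gscale c (\<phi> S)"
  by (simp add: lin_ext_superset[of "{S}"])

lemma grassmann_induct [case_names zero add]:
  fixes f :: "'k::field grassmann"
  assumes "P 0" and "\<And>S c f. P f \<Longrightarrow> P (Poly_Mapping.single S c + f)"
  shows "P f"
proof -
  have "P (\<Sum>S\<in>A. Poly_Mapping.single S (Poly_Mapping.lookup f S))" if "finite A" for A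
    using that by (induction A) (auto intro: assms)
  moreover have "(\<Sum>S\<in>Poly_Mapping.keys f. Poly_Mapping.single S (Poly_Mapping.lookup f S)) = f"
    by (rule poly_mapping_eqI)
       (auto simp: lookup_sum lookup_single when_def in_keys_iff)
  ultimately show ?thesis
    by (metis finite_keys)
qed

lemma lin_ext_zero [simp]: "lin_ext \<phi> 0 = 0"
  by (simp add: lin_ext_def)

lemma lin_ext_fun_add: "lin_ext (\<lambda>S. \<phi> S + \<psi> S) f = lin_ext \<phi> f + lin_ext \<psi> f"
  by (simp add: lin_ext_def grassmann.scale_right_distrib sum.distrib)

lemma lin_ext_fun_scale: "lin_ext (\<lambda>S. gscale c (\<phi> S)) f = gscale c (lin_ext \<phi> f)"
  by (simp add: lin_ext_def grassmann.scale_sum_right mult.commute)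

lemma gmul_add_left: "gmul (f + g) h = gmul f h + gmul g h"
  by (simp add: gmul_def lin_ext_add)

lemma gmul_add_right: "gmul f (g + h) = gmul f g + gmul f h"
  by (simp add: gmul_def lin_ext_add lin_ext_fun_add)

lemma gmul_scale_left: "gmul (gscale c f) g = gscale c (gmul f g)"
  by (simp add: gmul_def lin_ext_scale)

lemma gmul_scale_right: "gmul f (gscale c g) = gscale c (gmul f g)"
  by (simp add: gmul_def lin_ext_scale lin_ext_fun_scale)

lemma gmul_zero [simp]: "gmul 0 f = 0" "gmul f 0 = 0"
  by (simp_all add: gmul_def lin_ext_def)

lemma gmul_single:
  "gmul (Poly_Mapping.single S c) (Poly_Mapping.single T d) =
     (if S |\<inter>| T = {||} then Poly_Mapping.single (S |\<union>| T) (c * d * gsign S T) else 0)"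
  by (simp add: gmul_def)

lemma linear_X: "Vector_Spaces.linear gscale gscale (X i)"
  by unfold_locales (simp_all add: X_def gmul_add_right gmul_scale_right)

lemma linear_del: "Vector_Spaces.linear gscale gscale (del i)"
  unfolding del_def by (rule linear_lin_ext)

lemma finite_inversions [simp]: "finite {(s, t). s |\<in>| S \<and> t |\<in>| T \<and> (t::nat) < s}"
  by (rule finite_subset[of _ "fset S \<times> fset T"]) auto

lemma gsign_union_left:
  assumes "S |\<inter>| T = {||}"
  shows "gsign (S |\<union>| T) U = gsign S U * (gsign T U :: 'k::field)"
proof -
  have "{(s, t). s |\<in>| S |\<union>| T \<and> t |\<in>| U \<and> t < s} =
      {(s, t). s |\<in>| S \<and> t |\<in>| U \<and> t < s} \<union> {(s, t). s |\<in>| T \<and> t |\<in>| U \<and> t < s}"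
    by auto
  then show ?thesis
    unfolding gsign_def power_add[symmetric] using assms
    by (subst card_Un_disjoint[symmetric]) auto
qed

lemma gsign_union_right:
  assumes "S |\<inter>| T = {||}"
  shows "gsign U (S |\<union>| T) = gsign U S * (gsign U T :: 'k::field)"
proof -
  have "{(s, t). s |\<in>| U \<and> t |\<in>| S |\<union>| T \<and> t < s} =
      {(s, t). s |\<in>| U \<and> t |\<in>| S \<and> t < s} \<union> {(s, t). s |\<in>| U \<and> t |\<in>| T \<and> t < s}"
    by auto
  then show ?thesis
    unfolding gsign_def power_add[symmetric] using assms
    by (subst card_Un_disjoint[symmetric]) auto
qed

lemma gsign_finsert_left:
  "i |\<notin>| S \<Longrightarrow> gsign (finsert i S) U = gsign {|i|} U * (gsign S U :: 'k::field)"
  using gsign_union_left[of "{|i|}" S U] by simp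

lemma gsign_finsert_right:
  "i |\<notin>| S \<Longrightarrow> gsign U (finsert i S) = gsign U {|i|} * (gsign U S :: 'k::field)"
  using gsign_union_right[of "{|i|}" S U] by simp

lemma gsign_square [simp]: "gsign S T * gsign S T = (1 :: 'k::field)"
  unfolding gsign_def power_mult_distrib[symmetric] by simp

lemma gsign_square' [simp]: "gsign S T * (gsign S T * c) = (c :: 'k::field)"
  unfolding mult.assoc[symmetric] gsign_square by (rule mult_1_left)

lemma gsign_empty [simp]: "gsign {||} T = 1" "gsign S {||} = 1"
  by (simp_all add: gsign_def)

lemma gsign_refl [simp]: "gsign {|i|} {|i|} = 1"
proof -
  have "{(s, t). s |\<in>| {|i|} \<and> t |\<in>| {|i|} \<and> t < s} = {}"
    by auto
  then show ?thesis
    unfolding gsign_def by (metis card.empty power_0)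
qed

lemma gsign_swap:
  assumes "i |\<notin>| S"
  shows "gsign S {|i|} = (- 1) ^ fcard S * (gsign {|i|} S :: 'k::field)"
proof -
  have "{(s, t). s |\<in>| S \<and> t |\<in>| {|i|} \<and> t < s} = {s \<in> fset S. i < s} \<times> {i}"
       "{(s, t). s |\<in>| {|i|} \<and> t |\<in>| S \<and> t < s} = {i} \<times> {s \<in> fset S. s < i}"
    by auto
  then have *: "gsign S {|i|} = (- 1) ^ card {s \<in> fset S. i < s}"
     "gsign {|i|} S = (- 1 :: 'k) ^ card {s \<in> fset S. s < i}"
    by (simp_all add: gsign_def card_cartesian_product)
  have split: "fset S = {s \<in> fset S. i < s} \<union> {s \<in> fset S. s < i}"
  proof (intro equalityI subsetI)
    fix s assume s: "s \<in> fset S"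
    then have "s \<noteq> i" using assms by blast
    then have "i < s \<or> s < i" by linarith
    with s show "s \<in> {s \<in> fset S. i < s} \<union> {s \<in> fset S. s < i}" by blast
  qed blast
  have "card ({s \<in> fset S. i < s} \<union> {s \<in> fset S. s < i}) =
      card {s \<in> fset S. i < s} + card {s \<in> fset S. s < i}"
    by (rule card_Un_disjoint) auto
  then have "fcard S = card {s \<in> fset S. i < s} + card {s \<in> fset S. s < i}"
    unfolding fcard.rep_eq split[symmetric] .
  then have "(- 1 :: 'k) ^ fcard S * (- 1) ^ card {s \<in> fset S. s < i} =
      (- 1) ^ card {s \<in> fset S. i < s} *
      ((- 1) ^ card {s \<in> fset S. s < i} * (- 1) ^ card {s \<in> fset S. s < i})"
    by (simp only: power_add mult.assoc)
  also have "(- 1 :: 'k) ^ card {s \<in> fset S. s < i} * (- 1) ^ card {s \<in> fset S. s < i} = 1"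
    unfolding power_mult_distrib[symmetric] by simp
  finally show ?thesis
    unfolding * by simp
qed

lemma gmul_one [simp]: "gmul gone f = f" "gmul f gone = f"
  by (induction f rule: grassmann_induct)
     (simp_all add: gmul_add_left gmul_add_right gone_def gmul_single)

lemma gmul_assoc: "gmul (gmul f g) h = gmul f (gmul g h)"
proof (induction f rule: grassmann_induct)
  case (add S a f)
  have "gmul (gmul (Poly_Mapping.single S a) g) h = gmul (Poly_Mapping.single S a) (gmul g h)"
  proof (induction g rule: grassmann_induct)
    case (add T b g)
    have "gmul (gmul (Poly_Mapping.single S a) (Poly_Mapping.single T b)) h =
        gmul (Poly_Mapping.single S a) (gmul (Poly_Mapping.single T b) h)"
    proof (induction h rule: grassmann_induct)
      case (add U c h)
      have "gmul (gmul (Poly_Mapping.single S a) (Poly_Mapping.single T b))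
            (Poly_Mapping.single U c) =
          gmul (Poly_Mapping.single S a)
            (gmul (Poly_Mapping.single T b) (Poly_Mapping.single U c))"
        by (auto simp: gmul_single gsign_union_left gsign_union_right inf_sup_distrib1
              inf_sup_distrib2 sup_assoc mult_ac)
      with add show ?case by (simp add: gmul_add_right)
    qed simp
    with add show ?case by (simp add: gmul_add_right gmul_add_left)
  qed simp
  with add show ?case by (simp add: gmul_add_left)
qed simp

lemma gen_square: "gmul (gen i) (gen i) = 0"
  by (simp add: gen_def gmul_single)

lemma gen_anticommute: "gmul (gen i) (gen j) = - gmul (gen j) (gen i :: 'k::field grassmann)"
proof (cases "i = j")
  case False
  then have "gsign {|i|} {|j|} = - (gsign {|j|} {|i|} :: 'k)"
    using gsign_swap[of j "{|i|}", where 'k = 'k] by (simp add: fcard.rep_eq)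
  moreover have "{|i|} |\<union>| {|j|} = {|j|} |\<union>| {|i|}" by auto
  ultimately show ?thesis
    using False by (simp add: gen_def gmul_single single_uminus)
qed (simp add: gen_square)

lemma del_gen: "del i (gen j) = (if i = j then gone else 0)"
  by (simp add: del_def gen_def gone_def)

lemma del_odd:
  assumes "f \<in> parity_part b"
  shows "del i f \<in> parity_part (\<not> b)"
proof -
  have "even (fcard T) = (\<not> b)" if T: "T \<in> Poly_Mapping.keys (del i f)" for T
  proof -
    from T obtain S where S: "S \<in> Poly_Mapping.keys f" "i |\<in>| S" "T = S |-| {|i|}"
      unfolding del_def lin_ext_def in_keys_iff lookup_sum
      by (elim sum.not_neutral_contains_not_neutral)
         (auto simp: lookup_single when_def in_keys_iff split: if_splits)
    then have "fcard S = Suc (fcard T)"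
      by (metis fcard_Suc_fminus1)
    with S assms show ?thesis by (auto simp: parity_part_def)
  qed
  then show ?thesis by (simp add: parity_part_def)
qed

lemma del_superderivation:
  fixes f g :: "'k::field grassmann"
  shows "del i (gmul f g) = gmul (del i f) g + gmul (grade_involution f) (del i g)"
proof -
  have linear: "del i (f + g) = del i f + del i g" "del i 0 = (0 :: 'k grassmann)"
    "grade_involution (f + g) = grade_involution f + grade_involution g"
    "grade_involution 0 = (0 :: 'k grassmann)" for f g :: "'k grassmann"
    by (simp_all add: del_def grade_involution_def lin_ext_add)
  let ?s = "Poly_Mapping.single :: nat fset \<Rightarrow> 'k \<Rightarrow> 'k grassmann"
  have del_single: "del i (?s S c) = (if i |\<in>| S then ?s (S |-| {|i|}) (c * gsign {|i|} S) else 0)"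
    and inv_single: "grade_involution (?s S c) = ?s S (c * (- 1) ^ fcard S)" for S c
    by (simp_all add: del_def grade_involution_def)
  have basis: "del i (gmul (?s S c) (?s T d)) =
      gmul (del i (?s S c)) (?s T d) + gmul (grade_involution (?s S c)) (del i (?s T d))"
    for S T c d
  proof -
    obtain S' where S': "S = S' \<or> S = finsert i S'" "i |\<notin>| S'"
      by (rule that[of "S |-| {|i|}"]) auto
    obtain T' where T': "T = T' \<or> T = finsert i T'" "i |\<notin>| T'"
      by (rule that[of "T |-| {|i|}"]) auto
    have sw: "gsign S' {|i|} = (- 1) ^ fcard S' * (gsign {|i|} S' :: 'k)"
      by (rule gsign_swap) (rule S')
    have card: "fcard (finsert i S') = Suc (fcard S')"
      using S'(2) by (rule fcard_finsert_disjoint)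
    have diff: "finsert i A |-| {|i|} = A" if "i |\<notin>| A" for A
      using that by auto
    have sq: "(- 1) ^ n * ((- 1) ^ n * x) = x" for n and x :: 'k
      by (simp flip: power_mult_distrib mult.assoc)
    note rules = linear gmul_single del_single inv_single gsign_finsert_left[OF S'(2)]
      gsign_finsert_right[OF S'(2)] gsign_finsert_right[OF T'(2)] gsign_finsert_right[of i "S' |\<union>| T'"]
      gsign_union_right sw card diff sq S'(2) T'(2)
      mult_ac single_add[symmetric]
    consider "S = S'" "T = T'" | "S = finsert i S'" "T = T'"
      | "S = S'" "T = finsert i T'" | "S = finsert i S'" "T = finsert i T'"
      using S'(1) T'(1) by blast
    then show ?thesis
    proof cases
      case 1
      show ?thesis unfolding 1
        by (cases "S' |\<inter>| T' = {||}") (simp_all add: rules)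
    next
      case 2
      show ?thesis unfolding 2
        by (cases "S' |\<inter>| T' = {||}") (simp_all add: rules)
    next
      case 3
      show ?thesis unfolding 3
        by (cases "S' |\<inter>| T' = {||}") (simp_all add: rules)
    next
      case 4
      show ?thesis unfolding 4
        by (cases "S' |\<inter>| T' = {||}") (simp_all add: rules)
    qed
  qed
  show ?thesis
  proof (induction f rule: grassmann_induct)
    case (add S c f)
    have "del i (gmul (?s S c) g) =
        gmul (del i (?s S c)) g + gmul (grade_involution (?s S c)) (del i g)"
      by (induction g rule: grassmann_induct)
         (simp_all add: basis gmul_add_right linear)
    with add show ?case
      by (simp add: gmul_add_left linear)
  qed (simp add: linear)
qed

lemma del_eq_zero:
  assumes "\<And>S. S \<in> Poly_Mapping.keys f \<Longrightarrow> i |\<notin>| S"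
  shows "del i f = 0"
  unfolding del_def lin_ext_def
proof (rule sum.neutral, rule ballI)
  fix S assume "S \<in> Poly_Mapping.keys f"
  then have "i |\<notin>| S" by (rule assms)
  then show "gscale (Poly_Mapping.lookup f S)
      (if i |\<in>| S then Poly_Mapping.single (S |-| {|i|}) (gsign {|i|} S) else 0) = 0"
    by simp
qed

lemma X_zero [simp]: "X i 0 = 0"
  by (simp add: X_def)

lemma pivot_summand_eq_zero: "del (i + 2 * k) f = 0 \<Longrightarrow> pivot_summand i k f = 0"
proof (induction k arbitrary: i)
  case (Suc k)
  have "i + 2 + 2 * k = i + 2 * Suc k" by simp
  with Suc have "pivot_summand (i + 2) k f = 0" by metis
  then show ?case by (simp only: pivot_summand.simps comp_apply X_zero)
qed simp

lemma finite_pivot_summand: "finite {k. pivot_summand i k f \<noteq> 0}"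
proof -
  let ?A = "\<Union>S\<in>Poly_Mapping.keys f. fset S"
  have "i + 2 * k \<in> ?A" if "pivot_summand i k f \<noteq> 0" for k
  proof (rule ccontr)
    assume "i + 2 * k \<notin> ?A"
    then have "del (i + 2 * k) f = 0" by (intro del_eq_zero) auto
    with that show False by (simp add: pivot_summand_eq_zero)
  qed
  then have "{k. pivot_summand i k f \<noteq> 0} \<subseteq> (\<lambda>k. i + 2 * k) -` ?A" by auto
  moreover have "finite ((\<lambda>k. i + 2 * k) -` ?A)"
    by (rule finite_vimageI) (auto simp: inj_def)
  ultimately show ?thesis by (rule finite_subset)
qed

lemma V_rec: "V i f = del i f + X i (X (Suc i) (V (i + 2) f))"
proof -
  obtain N where N: "{k. pivot_summand i k f \<noteq> 0} \<union> {k. pivot_summand (i + 2) k f \<noteq> 0} \<subseteq> {..<N}"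
    using finite_nat_set_iff_bounded[THEN iffD1, OF finite_UnI[OF finite_pivot_summand finite_pivot_summand]]
    by (metis lessThan_iff subsetI)
  have X_sum: "X j (sum h B) = (\<Sum>b\<in>B. X j (h b))" for j and h :: "nat \<Rightarrow> 'a grassmann" and B
  proof -
    interpret Vector_Spaces.linear gscale gscale "X j :: 'a operator" by (rule linear_X)
    show ?thesis by (rule sum)
  qed
  have "V i f = (\<Sum>k<Suc N. pivot_summand i k f)"
    unfolding V_def using N by (intro Sum_any.expand_superset) (auto simp: less_Suc_eq)
  also have "\<dots> = del i f + (\<Sum>k<N. pivot_summand i (Suc k) f)"
    by (simp only: sum.lessThan_Suc_shift pivot_summand.simps(1))
  also have "(\<Sum>k<N. pivot_summand i (Suc k) f) =
      X i (X (Suc i) (\<Sum>k<N. pivot_summand (i + 2) k f))"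
    by (simp add: X_sum)
  also have "(\<Sum>k<N. pivot_summand (i + 2) k f) = V (i + 2) f"
    unfolding V_def using N by (intro Sum_any.expand_superset[symmetric]) auto
  finally show ?thesis .
qed

lemma weights_X_prod:
  assumes "range \<xi> \<subseteq> {0, 1}"
  shows "has_weights w a b \<Longrightarrow> has_weights (X_prod \<xi> n \<circ> w)
    (a - (\<Sum>i<n. int (\<xi> i) * 2 ^ i)) (b - (\<Sum>i<n. int (\<xi> i) * (- 1) ^ i))"
proof (induction n arbitrary: w a b)
  case 0
  then show ?case by simp
next
  case (Suc n)
  have "has_weights ((X n ^^ \<xi> n) \<circ> w) (a - int (\<xi> n) * 2 ^ n) (b - int (\<xi> n) * (- 1) ^ n)"
    using weights_mult[OF weights_X Suc.prems, of n] Suc.prems range_subsetD[OF assms, of n]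
    by auto
  from Suc.IH[OF this] show ?case
    by (simp only: X_prod.simps comp_assoc sum.lessThan_Suc diff_diff_eq add.commute)
qed

lemma weights_V_prod:
  assumes "range \<alpha> \<subseteq> {0, 1}"
  shows "has_weights w a b \<Longrightarrow> has_weights (w \<circ> V_prod \<alpha> n)
    (a + (\<Sum>i<n. int (\<alpha> i) * 2 ^ i)) (b + (\<Sum>i<n. int (\<alpha> i) * (- 1) ^ i))"
proof (induction n arbitrary: w a b)
  case 0
  then show ?case by simp
next
  case (Suc n)
  have "has_weights (w \<circ> (V n ^^ \<alpha> n)) (a + int (\<alpha> n) * 2 ^ n) (b + int (\<alpha> n) * (- 1) ^ n)"
    using weights_mult[OF Suc.prems weights_V, of n] Suc.prems range_subsetD[OF assms, of n]
    by auto
  from Suc.IH[OF this] show ?case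
    by (simp only: V_prod.simps comp_assoc sum.lessThan_Suc add.assoc add.commute)
qed

lemma weights_basis_monomial:
  assumes "range \<xi> \<subseteq> {0, 1}" "range \<alpha> \<subseteq> {0, 1}"
  shows "has_weights (X_prod \<xi> n \<circ> V n \<circ> V_prod \<alpha> n)
     (2 ^ n - (\<Sum>i<n. int (\<xi> i) * 2 ^ i) + (\<Sum>i<n. int (\<alpha> i) * 2 ^ i))
     ((- 1) ^ n - (\<Sum>i<n. int (\<xi> i) * (- 1) ^ i) + (\<Sum>i<n. int (\<alpha> i) * (- 1) ^ i))"
  by (intro weights_V_prod weights_X_prod weights_V assms)

lemma basis_monomial_has_weights:
  assumes "w \<in> basis_monomials"
  shows "\<exists>z1 z2. has_weights w z1 z2"
proof -
  have "\<exists>n \<xi> \<alpha>. range \<xi> \<subseteq> {0, 1} \<and> range \<alpha> \<subseteq> {0, 1} \<and> w = X_prod \<xi> n \<circ> V n \<circ> V_prod \<alpha> n"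
    using assms unfolding basis_monomials_def
  proof (elim UnE)
    assume "w \<in> {V 0}"
    then show ?thesis
      by (intro exI[of _ 0] exI[of _ "\<lambda>_. 0"]) auto
  next
    assume "w \<in> {V 1 \<circ> V_prod \<alpha> 1 |\<alpha>. range \<alpha> \<subseteq> {0, 1}}"
    then obtain \<alpha> where "range \<alpha> \<subseteq> {0, 1}" "w = V 1 \<circ> V_prod \<alpha> 1" by blast
    then show ?thesis
      by (intro exI[of _ 1] exI[of _ "\<lambda>_. 0"] exI[of _ \<alpha>]) auto
  qed blast+
  then show ?thesis using weights_basis_monomial by blast
qed

end

theory Submission
  imports Defs
begin

text \<open>
  Weights are determined by a nonzero operator: each \<open>x_i\<close> and \<open>v_i\<close> shifts the weight
  \<open>-\<Sum>_{s \<in> S} g(s)\<close> of a monomial \<open>x_S\<close> by a constant, for every \<open>g\<close> with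
  \<open>g(i+2) = g(i+1) + 2 g(i)\<close>, in particular for \<open>2^i\<close> and \<open>(-1)^i\<close>. Basis monomials are nonzero
  because \<open>v_{i+1}, v_{i+2}, \<dots>\<close> can never remove an \<open>x_i\<close> created by the tail of \<open>v_i\<close>, so that the
  lowest coefficient only sees the derivations \<open>\<partial>_i\<close>. With head \<open>v_n\<close> the weights then satisfy
  \<open>\<bar>Z_2\<bar> \<le> n + 1\<close>, whereas the restriction on the top two exponents \<open>\<xi>\<close> gives \<open>Z_1 > 2^{n-2}\<close>.
\<close>

section \<open>Coefficients of \<open>x_i\<close>, \<open>\<partial>_i\<close> and
  \<open>v_i\<close>, read off at the output monomial\<close>

lemma gsign_nonzero [simp]: "gsign S T \<noteq> (0 :: 'k::field)"
  by (simp add: gsign_def)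

lemma lookup_X:
  "Poly_Mapping.lookup (X i f) T =
     (if i |\<in>| T then gsign {|i|} (T |-| {|i|}) * Poly_Mapping.lookup f (T |-| {|i|}) else 0)"
proof (induction f rule: grassmann_induct)
  case (add S c f)
  have "Poly_Mapping.lookup (X i (Poly_Mapping.single S c)) T =
     (if i |\<in>| T then gsign {|i|} (T |-| {|i|}) *
        Poly_Mapping.lookup (Poly_Mapping.single S c) (T |-| {|i|}) else 0)"
    by (auto simp: X_def gen_def gmul_single lookup_single when_def)
  with add show ?case
    by (simp add: X_def gmul_add_right lookup_add distrib_left)
qed simp

lemma lookup_del:
  "Poly_Mapping.lookup (del i f) T =
     (if i |\<in>| T then 0 else gsign {|i|} (finsert i T) * Poly_Mapping.lookup f (finsert i T))"
proof (induction f rule: grassmann_induct)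
  case (add S c f)
  have "Poly_Mapping.lookup (del i (Poly_Mapping.single S c)) T =
     (if i |\<in>| T then 0 else gsign {|i|} (finsert i T) *
        Poly_Mapping.lookup (Poly_Mapping.single S c) (finsert i T))"
    by (auto simp: del_def lookup_single when_def)
  with add show ?case
    by (simp add: del_def lin_ext_add lookup_add distrib_left)
qed (simp add: del_def)

text \<open>Every monomial produced by the tail \<open>x_i x_{i+1} v_{i+2}\<close> contains
  \<open>x_i\<close>, so only \<open>\<partial>_i\<close> contributes at such a
  \<open>T\<close>.\<close>

lemma lookup_V_notin:
  assumes "i |\<notin>| T"
  shows "Poly_Mapping.lookup (V i f) T =
    gsign {|i|} (finsert i T) * Poly_Mapping.lookup f (finsert i T)"
  using assms by (simp add: V_rec[of i f] lookup_add lookup_X lookup_del)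

section \<open>Weights as shifts of monomials, and their uniqueness\<close>

lemma X_shift:
  assumes "Poly_Mapping.lookup (X i f) T \<noteq> 0"
  obtains S where "Poly_Mapping.lookup f S \<noteq> 0" "T = finsert i S" "i |\<notin>| S"
proof -
  have "i |\<in>| T" "Poly_Mapping.lookup f (T |-| {|i|}) \<noteq> 0"
    using assms by (auto simp: lookup_X split: if_splits)
  then show thesis
    by (intro that[of "T |-| {|i|}"]) auto
qed

text \<open>The recurrence for \<open>g\<close> gives \<open>g (i+2) - g (i+1) - g i = g i\<close>,
  so the tail \<open>x_i x_{i+1} v_{i+2}\<close> shifts by the same amount as
  \<open>\<partial>_i\<close>. The input monomial \<open>S\<close> is chosen before
  \<open>g\<close>, so that one \<open>S\<close> serves weight and superweight at once.\<close>

lemma V_shift: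
  assumes "Poly_Mapping.lookup (V i f) T \<noteq> 0"
  obtains S where "Poly_Mapping.lookup f S \<noteq> 0"
    and "\<And>g :: nat \<Rightarrow> int. (\<And>j. g (j + 2) = g (j + 1) + 2 * g j) \<Longrightarrow>
      sum g (fset S) = sum g (fset T) + g i"
proof -
  have "\<exists>S. Poly_Mapping.lookup f S \<noteq> 0 \<and>
      (\<forall>g :: nat \<Rightarrow> int. (\<forall>j. g (j + 2) = g (j + 1) + 2 * g j) \<longrightarrow>
        sum g (fset S) = sum g (fset T) + g i)"
    using assms
  \<comment> \<open>If \<open>i\<close> lies in \<open>T\<close>, only the tail contributes, and
    stripping \<open>x_i x_{i+1}\<close> from \<open>T\<close> leaves a smaller set for
    \<open>v_{i+2}\<close>.\<close>
  proof (induction "fcard T" arbitrary: T i rule: less_induct)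
    case less
    show ?case
    proof (cases "i |\<in>| T")
      case False
      with less.prems have "Poly_Mapping.lookup f (finsert i T) \<noteq> 0"
        by (simp add: lookup_V_notin)
      with False show ?thesis
        by (intro exI[of _ "finsert i T"]) (simp add: add.commute)
    next
      case True
      with less.prems have "Poly_Mapping.lookup (X i (X (Suc i) (V (i + 2) f))) T \<noteq> 0"
        unfolding V_rec[of i f] by (simp add: lookup_add lookup_del)
      then obtain U where U: "Poly_Mapping.lookup (V (i + 2) f) U \<noteq> 0"
          "T = finsert i (finsert (Suc i) U)" "i |\<notin>| finsert (Suc i) U" "Suc i |\<notin>| U"
        by (metis X_shift)
      from U(2-4) have "fcard U < fcard T"
        by (simp add: fcard_finsert_disjoint)
      from less.hyps[OF this U(1)] obtain S where S: "Poly_Mapping.lookup f S \<noteq> 0"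
        "\<And>g :: nat \<Rightarrow> int. (\<And>j. g (j + 2) = g (j + 1) + 2 * g j) \<Longrightarrow>
          sum g (fset S) = sum g (fset U) + g (i + 2)" by blast
      have "sum g (fset S) = sum g (fset T) + g i"
        if g: "\<forall>j. g (j + 2) = g (j + 1) + 2 * g j" for g :: "nat \<Rightarrow> int"
        using S(2)[of g] U(2-4) g[rule_format] by simp
      with S(1) show ?thesis by blast
    qed
  qed
  then show thesis using that by blast
qed

lemma has_weights_shift:
  assumes "has_weights w a b" "Poly_Mapping.lookup (w f) T \<noteq> 0"
  shows "\<exists>S. Poly_Mapping.lookup f S \<noteq> 0 \<and>
    a = (\<Sum>s\<in>fset S. 2 ^ s) - (\<Sum>s\<in>fset T. 2 ^ s) \<and>
    b = (\<Sum>s\<in>fset S. (- 1) ^ s) - (\<Sum>s\<in>fset T. (- 1) ^ s)"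
  using assms
proof (induction arbitrary: f T rule: has_weights.induct)
  case (weights_X n)
  then obtain S where "Poly_Mapping.lookup f S \<noteq> 0" "T = finsert n S" "n |\<notin>| S"
    by (rule X_shift)
  then show ?case by (intro exI[of _ S]) simp
next
  case (weights_V n)
  then obtain S where S: "Poly_Mapping.lookup f S \<noteq> 0"
    and shift: "\<And>g :: nat \<Rightarrow> int. (\<And>j. g (j + 2) = g (j + 1) + 2 * g j) \<Longrightarrow>
      sum g (fset S) = sum g (fset T) + g n"
    by (rule V_shift) blast
  \<comment> \<open>Both sequences satisfy the recurrence because 2 and -1 are the roots of
    \<open>t^2 = t + 2\<close>.\<close>
  show ?case
    using S shift[of "\<lambda>s. 2 ^ s"] shift[of "\<lambda>s. (- 1) ^ s"]
    by (intro exI[of _ S]) simp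
next
  case (weights_mult u a b w c d)
  from weights_mult.prems have "Poly_Mapping.lookup (u (w f)) T \<noteq> 0" by simp
  from weights_mult.IH(1)[OF this] obtain U where U: "Poly_Mapping.lookup (w f) U \<noteq> 0"
    "a = (\<Sum>s\<in>fset U. 2 ^ s) - (\<Sum>s\<in>fset T. 2 ^ s)"
    "b = (\<Sum>s\<in>fset U. (- 1) ^ s) - (\<Sum>s\<in>fset T. (- 1) ^ s)" by blast
  from weights_mult.IH(2)[OF U(1)] obtain S where "Poly_Mapping.lookup f S \<noteq> 0"
    "c = (\<Sum>s\<in>fset S. 2 ^ s) - (\<Sum>s\<in>fset U. 2 ^ s)"
    "d = (\<Sum>s\<in>fset S. (- 1) ^ s) - (\<Sum>s\<in>fset U. (- 1) ^ s)" by blast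
  with U(2,3) show ?case by (intro exI[of _ S]) simp
qed

text \<open>A single input monomial forces the \<open>S\<close> found by
  \<open>has_weights_shift\<close>; with a common output monomial \<open>T\<close>, both pairs of
  weights equal the same differences.\<close>

lemma has_weights_unique:
  assumes "has_weights w a b" "has_weights w c d"
    and "w (Poly_Mapping.single S 1) \<noteq> 0"
  shows "a = c" "b = d"
proof -
  from assms(3) obtain T where T: "Poly_Mapping.lookup (w (Poly_Mapping.single S 1)) T \<noteq> 0"
    by (metis lookup_zero poly_mapping_eqI)
  show "a = c" "b = d"
    using has_weights_shift[OF assms(1) T] has_weights_shift[OF assms(2) T]
    by (auto simp: lookup_single when_def split: if_splits)
qed

section \<open>Basis monomials are nonzero operators\<close>

text \<open>Factors are peeled off from the left, largest index first. The current index is never in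
  \<open>T\<close>, so \<open>lookup_V_notin\<close> turns each \<open>v_n\<close> into inserting
  \<open>n\<close> into \<open>T\<close>, up to sign.\<close>

lemma lookup_V_prod_nonzero:
  assumes "range \<alpha> \<subseteq> {0, 1}" "\<And>i. i |\<in>| T \<Longrightarrow> n \<le> i"
    and "fset S = fset T \<union> {i. i < n \<and> \<alpha> i = 1}"
    and "Poly_Mapping.lookup f S \<noteq> 0"
  shows "Poly_Mapping.lookup (V_prod \<alpha> n f) T \<noteq> 0"
  using assms(2,3)
proof (induction n arbitrary: T)
  case 0
  with assms(4) show ?case by (simp add: fset_inject)
next
  case (Suc n)
  have n: "n |\<notin>| T" using Suc.prems(1)[of n] by auto
  have "\<alpha> n = 0 \<or> \<alpha> n = 1" using range_subsetD[OF assms(1), of n] by simp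
  then show ?case
  proof
    assume \<alpha>: "\<alpha> n = 0"
    have "Poly_Mapping.lookup (V_prod \<alpha> n f) T \<noteq> 0"
      using Suc.prems \<alpha> by (intro Suc.IH) (auto simp: less_Suc_eq dest: Suc_leD)
    with \<alpha> show ?case by simp
  next
    assume \<alpha>: "\<alpha> n = 1"
    have "Poly_Mapping.lookup (V_prod \<alpha> n f) (finsert n T) \<noteq> 0"
      using Suc.prems \<alpha> by (intro Suc.IH) (auto simp: less_Suc_eq dest: Suc_leD)
    with \<alpha> n show ?case by (simp add: lookup_V_notin)
  qed
qed

text \<open>The factors act in order of decreasing index, so each \<open>x_n\<close> meets a
  monomial with only larger indices and cannot kill it.\<close>

lemma X_prod_nonzero:
  assumes "range \<xi> \<subseteq> {0, 1}" "\<And>i. i |\<in>| T \<Longrightarrow> n \<le> i"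
    and "Poly_Mapping.lookup f T \<noteq> 0"
  shows "X_prod \<xi> n f \<noteq> 0"
  using assms(2,3)
proof (induction n arbitrary: T f)
  case 0
  then show ?case by auto
next
  case (Suc n)
  have n: "n |\<notin>| T" using Suc.prems(1)[of n] by auto
  have "\<xi> n = 0 \<or> \<xi> n = 1" using range_subsetD[OF assms(1), of n] by simp
  then show ?case
  proof
    assume "\<xi> n = 0"
    with Suc.IH[of T f] Suc.prems show ?case by (simp add: Suc_leD)
  next
    assume \<xi>: "\<xi> n = 1"
    have "Poly_Mapping.lookup (X n f) (finsert n T) \<noteq> 0"
      using n Suc.prems(2) by (simp add: lookup_X)
    moreover have "n \<le> i" if "i |\<in>| finsert n T" for i
      using that Suc.prems(1)[of i] by auto
    ultimately have "X_prod \<xi> n (X n f) \<noteq> 0" by (rule Suc.IH[rotated])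
    with \<xi> show ?case by simp
  qed
qed

lemma basis_monomial_nonzero:
  assumes "range \<xi> \<subseteq> {0, 1}" "range \<alpha> \<subseteq> {0, 1}"
  shows "\<exists>S. (X_prod \<xi> n \<circ> V n \<circ> V_prod \<alpha> n) (Poly_Mapping.single S (1 :: 'k::field)) \<noteq> 0"
proof -
  \<comment> \<open>\<open>S\<close> collects the indices of all pivot factors, so that removing
    them one by one leaves a nonzero constant coefficient.\<close>
  define S where "S = Abs_fset ({n} \<union> {i. i < n \<and> \<alpha> i = 1})"
  have S: "fset S = fset {|n|} \<union> {i. i < n \<and> \<alpha> i = 1}"
    by (simp add: S_def Abs_fset_inverse)
  let ?f = "Poly_Mapping.single S (1 :: 'k)"
  have "Poly_Mapping.lookup (V_prod \<alpha> n ?f) {|n|} \<noteq> 0"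
    by (rule lookup_V_prod_nonzero[OF assms(2) _ S]) auto
  then have "Poly_Mapping.lookup (V n (V_prod \<alpha> n ?f)) {||} \<noteq> 0"
    by (simp add: lookup_V_notin)
  then have "X_prod \<xi> n (V n (V_prod \<alpha> n ?f)) \<noteq> 0"
    by (intro X_prod_nonzero[OF assms(1)]) auto
  then show ?thesis by auto
qed

section \<open>Normal form and numerical bounds\<close>

lemma basis_monomialE:
  assumes "w \<in> basis_monomials"
  obtains n \<xi> \<alpha> where "range \<xi> \<subseteq> {0, 1}" "range \<alpha> \<subseteq> {0, 1}"
    "w = X_prod \<xi> n \<circ> V n \<circ> V_prod \<alpha> n"
    "n < 2 \<Longrightarrow> \<xi> = (\<lambda>_. 0)" "2 \<le> n \<Longrightarrow> \<xi> (n - 2) + \<xi> (n - 1) \<le> 1 + \<alpha> (n - 1)"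
  using assms unfolding basis_monomials_def
proof (elim UnE)
  assume "w \<in> {V 0}"
  then show thesis by (intro that[of "\<lambda>_. 0" "\<lambda>_. 0" 0]) auto
next
  assume "w \<in> {V 1 \<circ> V_prod \<alpha> 1 |\<alpha>. range \<alpha> \<subseteq> {0, 1}}"
  then obtain \<alpha> where "range \<alpha> \<subseteq> {0, 1}" "w = V 1 \<circ> V_prod \<alpha> 1" by blast
  then show thesis by (intro that[of "\<lambda>_. 0" \<alpha> 1]) auto
next
  assume "w \<in> {X_prod \<xi> 2 \<circ> V 2 \<circ> V_prod \<alpha> 2 |\<xi> \<alpha>.
    range \<xi> \<subseteq> {0, 1} \<and> range \<alpha> \<subseteq> {0, 1} \<and> \<xi> 0 + \<xi> 1 \<le> 1}"
  then obtain \<xi> \<alpha> where "range \<xi> \<subseteq> {0, 1}" "range \<alpha> \<subseteq> {0, 1}" "\<xi> 0 + \<xi> 1 \<le> 1"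
    "w = X_prod \<xi> 2 \<circ> V 2 \<circ> V_prod \<alpha> 2" by blast
  then show thesis by (intro that[of \<xi> \<alpha> 2]) auto
next
  assume "w \<in> {X_prod \<xi> n \<circ> V n \<circ> V_prod \<alpha> n |n \<xi> \<alpha>.
    3 \<le> n \<and> range \<xi> \<subseteq> {0, 1} \<and> range \<alpha> \<subseteq> {0, 1} \<and>
    \<xi> (n - 2) + \<xi> (n - 1) \<le> 1 + \<alpha> (n - 1) \<and>
    (n = 3 \<and> \<xi> 0 = 1 \<and> \<xi> 2 = 1 \<longrightarrow> \<xi> 1 = 0 \<and> \<alpha> 2 = 1)}"
  then obtain n \<xi> \<alpha> where "3 \<le> n" "range \<xi> \<subseteq> {0, 1}" "range \<alpha> \<subseteq> {0, 1}"
    "\<xi> (n - 2) + \<xi> (n - 1) \<le> 1 + \<alpha> (n - 1)"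
    "w = X_prod \<xi> n \<circ> V n \<circ> V_prod \<alpha> n" by blast
  then show thesis by (intro that[of \<xi> \<alpha> n]) auto
qed

lemma weighted_sum_less:
  assumes "range \<xi> \<subseteq> {0, 1}"
  shows "(\<Sum>i<n. int (\<xi> i) * 2 ^ i) < 2 ^ n"
proof (induction n)
  case (Suc n)
  have "\<xi> n = 0 \<or> \<xi> n = 1" using range_subsetD[OF assms, of n] by simp
  then show ?case
  proof
    assume "\<xi> n = 0"
    moreover have "(2 :: int) ^ n \<le> 2 ^ Suc n" by (rule power_increasing) simp_all
    ultimately show ?thesis using order.strict_trans2[OF Suc] by simp
  next
    assume "\<xi> n = 1"
    with Suc show ?thesis by simp
  qed
qed simp

text \<open>For \<open>n = m + 2\<close>, the two top \<xi> cost at most \<open>2 * 2^m\<close>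
  beyond what \<alpha> at \<open>m + 1\<close> gives back, and the lower ones cost less than
  \<open>2^m\<close>. Of \<open>2^n = 4 * 2^m\<close> more than \<open>2^m\<close> remains; the
  factor 4 keeps the bound integral.\<close>

lemma weight_lower_bound:
  assumes "range \<xi> \<subseteq> {0, 1}" "range \<alpha> \<subseteq> {0, 1}"
    and "n < 2 \<Longrightarrow> \<xi> = (\<lambda>_. 0)" "2 \<le> n \<Longrightarrow> \<xi> (n - 2) + \<xi> (n - 1) \<le> 1 + \<alpha> (n - 1)"
  shows "2 ^ n < 4 * (2 ^ n - (\<Sum>i<n. int (\<xi> i) * 2 ^ i) + (\<Sum>i<n. int (\<alpha> i) * 2 ^ i))"
proof (cases "n < 2")
  case True
  have "p < 4 * (p + q)" if "0 < p" "0 \<le> q" for p q :: int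
    using that by (simp add: distrib_left)
  from this[of "2 ^ n" "\<Sum>i<n. int (\<alpha> i) * 2 ^ i"] show ?thesis
    using assms(3)[OF True] by (simp add: sum_nonneg)
next
  case False
  then obtain m where n: "n = Suc (Suc m)"
    by (metis One_nat_def Suc_1 less_Suc_eq_0_disj not0_implies_Suc not_less_eq)
  have top: "\<xi> m + \<xi> (Suc m) \<le> 1 + \<alpha> (Suc m)" using assms(4) n by simp
  have "\<xi> m \<le> 1" "\<xi> (Suc m) \<le> 1" "\<alpha> (Suc m) \<le> 1"
    using range_subsetD[OF assms(1), of m] range_subsetD[OF assms(1), of "Suc m"]
      range_subsetD[OF assms(2), of "Suc m"] by auto
  \<comment> \<open>If \<alpha> is 0, at most one \<xi> is 1 and the left side is at most 2; if
    \<alpha> is 1, it is at most 3, against 4.\<close>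
  then have "\<xi> m + 2 * \<xi> (Suc m) \<le> 2 + 2 * \<alpha> (Suc m)"
    using top by linarith
  then have "int (\<xi> m) + 2 * int (\<xi> (Suc m)) \<le> 2 + 2 * int (\<alpha> (Suc m))"
    by linarith
  then have "(int (\<xi> m) + 2 * int (\<xi> (Suc m))) * 2 ^ m \<le> (2 + 2 * int (\<alpha> (Suc m))) * 2 ^ m"
    by (rule mult_right_mono) simp
  moreover define A where "A = (\<Sum>i<Suc m. int (\<alpha> i) * 2 ^ i)"
  then have "0 \<le> A" by (metis (no_types, lifting) of_nat_0_le_iff sum_nonneg zero_le_mult_iff zero_le_numeral zero_le_power)
  moreover have "(\<Sum>i<n. int (\<alpha> i) * 2 ^ i) = A + int (\<alpha> (Suc m)) * (2 * 2 ^ m)"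
    by (simp add: n A_def)
  moreover note weighted_sum_less[OF assms(1), of m]
  ultimately show ?thesis
    by (simp add: n algebra_simps del: sum.lessThan_Suc) (simp add: algebra_simps)
qed

text \<open>Pairing \<alpha> and \<xi> at equal indices leaves coefficients in {-1, 0, 1}, so the
  cost is 1 per index, not 2, plus 1 for the head \<open>v_n\<close>.\<close>

lemma superweight_upper_bound:
  assumes "range \<xi> \<subseteq> {0, 1}" "range \<alpha> \<subseteq> {0, 1}"
  shows "\<bar>(- 1) ^ n - (\<Sum>i<n. int (\<xi> i) * (- 1) ^ i) + (\<Sum>i<n. int (\<alpha> i) * (- 1) ^ i)\<bar>
    \<le> int n + 1"
proof -
  have "\<bar>\<Sum>i<n. (int (\<alpha> i) - int (\<xi> i)) * (- 1) ^ i\<bar> \<le> (\<Sum>i<n. 1)"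
  proof (rule order_trans[OF sum_abs sum_mono])
    fix i
    have "\<alpha> i \<in> {0, 1}" "\<xi> i \<in> {0, 1}" using assms by auto
    then show "\<bar>(int (\<alpha> i) - int (\<xi> i)) * (- 1) ^ i\<bar> \<le> 1"
      by (auto simp: abs_mult)
  qed
  then have "\<bar>(\<Sum>i<n. int (\<alpha> i) * (- 1) ^ i) - (\<Sum>i<n. int (\<xi> i) * (- 1) ^ i)\<bar> \<le> int n"
    by (simp add: left_diff_distrib sum_subtractf)
  moreover have "\<bar>(- 1) ^ n :: int\<bar> = 1" by simp
  ultimately show ?thesis by linarith
qed

theorem theorem9p3:
  fixes w :: "'k::field operator" and Z1 Z2 :: int
  assumes "w \<in> basis_monomials"
    and "has_weights w Z1 Z2"
  shows "0 < Z1 \<and> real_of_int \<bar>Z2\<bar> < log 2 (real_of_int Z1) + 3"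
proof -
  from assms(1) obtain n \<xi> \<alpha> where \<xi>\<alpha>: "range \<xi> \<subseteq> {0, 1}" "range \<alpha> \<subseteq> {0, 1}"
    and w: "w = X_prod \<xi> n \<circ> V n \<circ> V_prod \<alpha> n"
    and top: "n < 2 \<Longrightarrow> \<xi> = (\<lambda>_. 0)" "2 \<le> n \<Longrightarrow> \<xi> (n - 2) + \<xi> (n - 1) \<le> 1 + \<alpha> (n - 1)"
    by (rule basis_monomialE) blast
  obtain S where "w (Poly_Mapping.single S 1) \<noteq> 0"
    using basis_monomial_nonzero[OF \<xi>\<alpha>] w by blast
  \<comment> \<open>Nonvanishing identifies the arbitrary given weights with the explicit
    sums.\<close>
  note Z = has_weights_unique[OF assms(2)[unfolded w] weights_basis_monomial[OF \<xi>\<alpha>] this[unfolded w]]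
  have Z1: "2 ^ n < 4 * Z1"
    unfolding Z(1) by (rule weight_lower_bound[OF \<xi>\<alpha> top])
  have pos: "0 < Z1"
    using Z1 zero_less_power[of "2 :: int" n] by linarith
  have "(2 :: real) ^ n < 4 * real_of_int Z1"
    using Z1 by (metis of_int_less_iff of_int_mult of_int_numeral of_int_power)
  \<comment> \<open>This yields \<open>n - 2 < log 2 Z1\<close>; adding 3 matches the superweight
    bound \<open>n + 1\<close>.\<close>
  then have "log 2 (2 ^ n) < log 2 (2 ^ 2 * real_of_int Z1)"
    using pos by (subst log_less_cancel_iff) auto
  also have "\<dots> = log 2 (real_of_int Z1) + 2"
    using pos by (simp only: log_mult log_nat_power) simp
  finally have "real n < log 2 (real_of_int Z1) + 2"
    by (simp add: log_nat_power)
  moreover have "\<bar>Z2\<bar> \<le> int n + 1"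
    unfolding Z(2) by (rule superweight_upper_bound[OF \<xi>\<alpha>])
  then have "real_of_int \<bar>Z2\<bar> \<le> real n + 1"
    by linarith
  ultimately show ?thesis using pos by linarith
qed

end
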